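(* Let $p>2$ be a prime and let $G$ be a finite $p$-group of nilpotency class $n$, where $n\ge 4$. Suppose that $|Z(G)|=p$, that $\exp(\gamma_{n-1}(G))=p$, and that $Z(C_G(x))\le \gamma_{n-1}(G)$ for all $x\in \gamma_{n-1}(G)\setminus Z(G)$. Then $G$ has a non-inner automorphism of order $p$ that fixes $\Phi(G)$ element-wise.
   Context: For a group $G$, $\gamma_m(G)$ denotes the $m$th term of the lower central series of $G$ (with $\gamma_1(G)=G$ and $\gamma_{m+1}(G)=[\gamma_m(G),G]$), so nilpotency class $n$ means $\gamma_{n+1}(G)=1\ne\gamma_n(G)$. $Z(H)$ denotes the center of a group $H$, $C_G(x)$ the centralizer of $x$ in $G$, $\Phi(G)$ the Frattini subgroup of $G$, and $\exp(H)$ the exponent of a finite group $H$. An automorphism $\alpha$ of $G$ fixes $\Phi(G)$ element-wise if $\alpha(u)=u$ for every $u\in\Phi(G)$; it is non-inner if it is not conjugation by an element of $G$. *)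

theory Defs
  imports "HOL-Algebra.Algebra"
begin

definition finite_p_group :: "nat \<Rightarrow> ('a, 'b) monoid_scheme \<Rightarrow> bool"
  where "finite_p_group p G \<longleftrightarrow>
    group G \<and> finite (carrier G) \<and> (\<exists>k. order G = p ^ k)"

text \<open>Commutators follow the convention of \<^const>\<open>derived\<close>. For subgroups \<open>H\<close> and \<open>K\<close> the
  convention \<open>h\<inverse>k\<inverse>hk\<close> produces the same set of generators.\<close>

definition commutator_subgroup :: "('a, 'b) monoid_scheme \<Rightarrow> 'a set \<Rightarrow> 'a set \<Rightarrow> 'a set"
  where "commutator_subgroup G H K =
    generate G (\<Union>h \<in> H. \<Union>k \<in> K. {h \<otimes>\<^bsub>G\<^esub> k \<otimes>\<^bsub>G\<^esub> inv\<^bsub>G\<^esub> h \<otimes>\<^bsub>G\<^esub> inv\<^bsub>G\<^esub> k})"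

text \<open>The series is indexed from 1; the value at index 0 is a dummy.\<close>

fun lower_central :: "('a, 'b) monoid_scheme \<Rightarrow> nat \<Rightarrow> 'a set"
  where
    "lower_central G 0 = carrier G"
  | "lower_central G (Suc 0) = carrier G"
  | "lower_central G (Suc (Suc m)) =
       commutator_subgroup G (lower_central G (Suc m)) (carrier G)"

text \<open>The guard \<open>n > 0\<close> only makes the trivial group have class 0.\<close>

definition has_nilpotency_class :: "('a, 'b) monoid_scheme \<Rightarrow> nat \<Rightarrow> bool"
  where "has_nilpotency_class G n \<longleftrightarrow>
    lower_central G (n + 1) = {\<one>\<^bsub>G\<^esub>} \<and> (n > 0 \<longrightarrow> lower_central G n \<noteq> {\<one>\<^bsub>G\<^esub>})"

definition center :: "('a, 'b) monoid_scheme \<Rightarrow> 'a set"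
  where "center G = {z \<in> carrier G. \<forall>g \<in> carrier G. z \<otimes>\<^bsub>G\<^esub> g = g \<otimes>\<^bsub>G\<^esub> z}"

definition centralizer :: "('a, 'b) monoid_scheme \<Rightarrow> 'a \<Rightarrow> 'a set"
  where "centralizer G x = {g \<in> carrier G. g \<otimes>\<^bsub>G\<^esub> x = x \<otimes>\<^bsub>G\<^esub> g}"

definition maximal_subgroup :: "'a set \<Rightarrow> ('a, 'b) monoid_scheme \<Rightarrow> bool"
  where "maximal_subgroup M G \<longleftrightarrow>
    subgroup M G \<and> M \<noteq> carrier G \<and>
    (\<forall>H. subgroup H G \<and> M \<subseteq> H \<longrightarrow> H = M \<or> H = carrier G)"

definition frattini :: "('a, 'b) monoid_scheme \<Rightarrow> 'a set"
  where "frattini G = carrier G \<inter> \<Inter> {M. maximal_subgroup M G}"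

definition group_exponent :: "('a, 'b) monoid_scheme \<Rightarrow> nat"
  where "group_exponent G = (LEAST e. e > 0 \<and> (\<forall>x \<in> carrier G. x [^]\<^bsub>G\<^esub> e = \<one>\<^bsub>G\<^esub>))"

text \<open>Elements of \<^term>\<open>auto G\<close> are extensional functions, hence the restriction below.\<close>

definition inner_auto :: "('a, 'b) monoid_scheme \<Rightarrow> ('a \<Rightarrow> 'a) set"
  where "inner_auto G =
    (\<lambda>g. \<lambda>x \<in> carrier G. g \<otimes>\<^bsub>G\<^esub> x \<otimes>\<^bsub>G\<^esub> inv\<^bsub>G\<^esub> g) ` carrier G"

end

theory Submission
  imports Defs "HOL-Number_Theory.Cong"
begin

text \<open>
  Pick \<open>x \<in> \<gamma>\<^sub>n\<^sub>-\<^sub>1(G)\<close> outside \<open>Z(G)\<close>. As \<open>[x, G] \<subseteq> \<gamma>\<^sub>n(G) \<subseteq> Z(G) = \<langle>c\<rangle>\<close>, we have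
  \<open>[x, g] = c\<^sup>k\<close> where \<open>k = k(g)\<close> is additive modulo \<open>p\<close>, with kernel the maximal subgroup
  \<open>M = C\<^sub>G(x)\<close>. Since \<open>p\<close> is odd and \<open>x\<^sup>p = 1\<close>, there is an automorphism \<open>\<alpha>\<close> of order \<open>p\<close> that
  fixes \<open>M\<close> (hence \<open>\<Phi>(G)\<close>) element-wise and sends some \<open>g \<notin> M\<close> into \<open>g x Z(G)\<close>. If \<open>\<alpha>\<close> were
  conjugation by \<open>h\<close>, then \<open>h \<in> Z(M) \<subseteq> \<gamma>\<^sub>n\<^sub>-\<^sub>1(G)\<close>, so \<open>[h, g]\<close> and therefore \<open>x\<close> would be
  central.
\<close>

section \<open>Central elements and the lower central series\<close>

lemma (in group) inv_commute:
  assumes "a \<in> carrier G" "b \<in> carrier G" "a \<otimes> b = b \<otimes> a"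
  shows "inv a \<otimes> b = b \<otimes> inv a"
proof -
  have "a \<otimes> b \<otimes> inv a = b"
    using assms by (simp add: m_assoc)
  then show ?thesis
    using assms by (metis inv_closed inv_solve_left m_assoc m_closed)
qed

lemma (in group) subgroup_nat_pow_closed:
  assumes "subgroup H G" "a \<in> H"
  shows "a [^] (i::nat) \<in> H"
  using assms by (induction i) (auto simp: subgroup.one_closed subgroup.m_closed)

lemma (in group) center_closed: "c \<in> center G \<Longrightarrow> c \<in> carrier G"
  by (simp add: center_def)

lemma (in group) center_commute: "\<lbrakk>c \<in> center G; g \<in> carrier G\<rbrakk> \<Longrightarrow> c \<otimes> g = g \<otimes> c"
  by (simp add: center_def)

lemma (in group) centerI:
  assumes "c \<in> carrier G" "\<And>g. g \<in> carrier G \<Longrightarrow> c \<otimes> g = g \<otimes> c"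
  shows "c \<in> center G"
  using assms unfolding center_def by blast

lemma (in group) subgroup_center: "subgroup (center G) G"
proof (rule subgroupI)
  show "center G \<subseteq> carrier G" "center G \<noteq> {}"
    by (auto simp: center_def)
next
  fix a assume "a \<in> center G"
  then show "inv a \<in> center G"
    by (metis centerI center_closed center_commute inv_closed inv_commute)
next
  fix a b assume a: "a \<in> center G" and b: "b \<in> center G"
  show "a \<otimes> b \<in> center G"
  proof (rule centerI)
    fix g assume g: "g \<in> carrier G"
    show "a \<otimes> b \<otimes> g = g \<otimes> (a \<otimes> b)"
      using a b g by (metis center_closed center_commute m_assoc)
  qed (simp add: a b center_closed)
qed

lemma (in group) subgroup_centralizer:
  assumes x: "x \<in> carrier G"
  shows "subgroup (centralizer G x) G"
proof (rule subgroupI)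
  show "centralizer G x \<subseteq> carrier G" "centralizer G x \<noteq> {}"
    using x by (auto simp: centralizer_def)
next
  fix a assume "a \<in> centralizer G x"
  then show "inv a \<in> centralizer G x"
    using inv_commute [of a x] x by (simp add: centralizer_def)
next
  fix a b assume "a \<in> centralizer G x" "b \<in> centralizer G x"
  then show "a \<otimes> b \<in> centralizer G x"
    using x by (auto simp: centralizer_def) (metis m_assoc)
qed

lemma (in group) commutator_in_commutator_subgroup:
  assumes "h \<in> H" "k \<in> K"
  shows "h \<otimes> k \<otimes> inv h \<otimes> inv k \<in> commutator_subgroup G H K"
  unfolding commutator_subgroup_def using assms by (blast intro: generate.incl)

text \<open>Needed in contrapositive form: a nontrivial \<open>lower_central G n\<close> yields an
  element of \<open>lower_central G (n - 1)\<close> that fails to commute with some element of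
  \<open>G\<close>.\<close>

lemma (in group) commutator_subgroup_trivial:
  assumes "H \<subseteq> carrier G" "K \<subseteq> carrier G" "\<And>h k. \<lbrakk>h \<in> H; k \<in> K\<rbrakk> \<Longrightarrow> h \<otimes> k = k \<otimes> h"
  shows "commutator_subgroup G H K = {\<one>}"
proof -
  have "h \<otimes> k \<otimes> inv h \<otimes> inv k = \<one>" if hk: "h \<in> H" "k \<in> K" for h k
  proof -
    have G: "h \<in> carrier G" "k \<in> carrier G"
      using assms(1,2) hk by auto
    have "h \<otimes> k \<otimes> inv h \<otimes> inv k = k \<otimes> h \<otimes> inv h \<otimes> inv k"
      using assms(3) [OF hk] by simp
    also have "\<dots> = \<one>"
      using G by (simp add: m_assoc)
    finally show ?thesis .
  qed
  then have "(\<Union>h \<in> H. \<Union>k \<in> K. {h \<otimes> k \<otimes> inv h \<otimes> inv k}) \<subseteq> {\<one>}"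
    by auto
  then have "commutator_subgroup G H K \<subseteq> {\<one>}"
    unfolding commutator_subgroup_def using mono_generate generate_one by blast
  then show ?thesis
    unfolding commutator_subgroup_def using generate.one by fastforce
qed

text \<open>Passes from a commutator to the inverse-free relation in which the exponents
  \<open>k\<close> are specified below.\<close>

lemma (in group) commutator_mult:
  assumes "h \<in> carrier G" "k \<in> carrier G"
  shows "h \<otimes> k = (h \<otimes> k \<otimes> inv h \<otimes> inv k) \<otimes> (k \<otimes> h)"
proof -
  have "inv k \<otimes> (k \<otimes> h) = h"
    using assms by (simp flip: m_assoc)
  then show ?thesis
    using assms by (simp add: m_assoc)
qed

lemma (in group) commute_if_commutator_one:
  assumes "h \<in> carrier G" "k \<in> carrier G" "h \<otimes> k \<otimes> inv h \<otimes> inv k = \<one>"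
  shows "h \<otimes> k = k \<otimes> h"
proof -
  have "h \<otimes> k = (h \<otimes> k \<otimes> inv h \<otimes> inv k) \<otimes> (k \<otimes> h)"
    using assms(1,2) by (rule commutator_mult)
  then show ?thesis
    using assms by simp
qed

lemma (in group) subgroup_lower_central: "subgroup (lower_central G m) G"
proof (induction m rule: induct_nat_012)
  case (ge2 m)
  then have "(\<Union>h \<in> lower_central G (Suc m). \<Union>k \<in> carrier G. {h \<otimes> k \<otimes> inv h \<otimes> inv k}) \<subseteq> carrier G"
    by (auto dest: subgroup.mem_carrier)
  then show ?case
    by (simp add: commutator_subgroup_def generate_is_subgroup)
qed (auto simp: subgroup_self)

lemmas (in group) lower_central_subset = subgroup.subset [OF subgroup_lower_central]

section \<open>Automorphisms and maximal subgroups from commutators of prime order\<close>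

text \<open>The setting of the construction, detached from the lower central series. The exponents
  \<open>k g\<close> are arbitrary natural representatives, determined only modulo \<open>p\<close>;
  hence the congruences in \<open>k_mult\<close> and \<open>k_pow\<close>.\<close>

locale prime_commutator = group +
  fixes p :: nat and x c :: 'a and k :: "'a \<Rightarrow> nat"
  assumes prime_p: "Factorial_Ring.prime p" and odd_p: "odd p"
    and x_closed [simp]: "x \<in> carrier G" and x_pow_p: "x [^] p = \<one>"
    and c_center: "c \<in> center G" and ord_c: "ord c = p"
    and k: "g \<in> carrier G \<Longrightarrow> x \<otimes> g = c [^] k g \<otimes> (g \<otimes> x)"
begin

section \<open>Powers of the central element \<open>c\<close>\<close>

lemma c_closed [simp]: "c \<in> carrier G"
  using c_center by (rule center_closed)

lemma c_pow_center: "c [^] (i::nat) \<in> center G"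
  using subgroup_center c_center by (rule subgroup_nat_pow_closed)

lemmas c_pow_commute = center_commute [OF c_pow_center]

lemma pow_cong:
  assumes "a \<in> carrier G" "a [^] p = \<one>" "[i = j] (mod p)"
  shows "a [^] (i::nat) = a [^] j"
proof -
  have "a [^] m = a [^] (m mod p)" for m :: nat
    using assms(1,2)
    by (metis div_mult_mod_eq l_one mult.commute nat_pow_closed nat_pow_mult nat_pow_one nat_pow_pow)
  then show ?thesis
    using assms(3) unfolding cong_def by metis
qed

lemma c_pow_p: "c [^] p = \<one>"
  using ord_c pow_ord_eq_1 [of c] by simp

lemma c_pow_eq_iff: "c [^] (i::nat) = c [^] j \<longleftrightarrow> [i = j] (mod p)"
proof
  assume eq: "c [^] i = c [^] j"
  have "c [^] (int i) = c [^] (int j)"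
    using eq by (simp add: int_pow_int)
  then have "int p dvd int i - int j"
    using int_pow_eq [of c "int i" "int j"] ord_c by (simp add: dvd_diff_commute)
  then show "[i = j] (mod p)"
    by (simp add: cong_iff_dvd_diff flip: cong_int_iff)
qed (simp add: pow_cong c_pow_p)

section \<open>The exponent map \<open>k\<close> modulo \<open>p\<close> and its kernel\<close>

lemma k_cong_iff:
  assumes g: "g \<in> carrier G"
  shows "[k g = i] (mod p) \<longleftrightarrow> x \<otimes> g = c [^] i \<otimes> (g \<otimes> x)"
  using g by (simp add: k c_pow_eq_iff)

lemma centralizer_iff:
  assumes g: "g \<in> carrier G"
  shows "g \<in> centralizer G x \<longleftrightarrow> [k g = 0] (mod p)"
  using g k_cong_iff [OF g, of 0] by (auto simp: centralizer_def)

text \<open>Moving \<open>x\<close> past \<open>g\<close> and then past \<open>h\<close> releases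
  one power of \<open>c\<close> each time; both are central and can be collected in front.\<close>

lemma k_mult:
  assumes g: "g \<in> carrier G" and h: "h \<in> carrier G"
  shows "[k (g \<otimes> h) = k g + k h] (mod p)"
proof -
  have "x \<otimes> (g \<otimes> h) = c [^] k g \<otimes> (g \<otimes> (x \<otimes> h))"
    using g h by (metis k m_assoc m_closed nat_pow_closed x_closed c_closed)
  also have "\<dots> = c [^] k g \<otimes> ((g \<otimes> c [^] k h) \<otimes> (h \<otimes> x))"
    using g h by (simp add: k m_assoc)
  also have "\<dots> = c [^] (k g + k h) \<otimes> (g \<otimes> h \<otimes> x)"
    using g h unfolding c_pow_commute [OF g, symmetric]
    by (simp add: m_assoc flip: nat_pow_mult)
  finally show ?thesis
    using g h by (simp add: k_cong_iff)
qed

lemma k_pow: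
  assumes g: "g \<in> carrier G"
  shows "[k (g [^] (i::nat)) = i * k g] (mod p)"
proof (induction i)
  case 0
  show ?case by (simp add: k_cong_iff)
next
  case (Suc i)
  have "[k (g [^] i \<otimes> g) = k (g [^] i) + k g] (mod p)"
    using g by (simp add: k_mult)
  also have "[k (g [^] i) + k g = i * k g + k g] (mod p)"
    using Suc.IH by (simp add: cong_add)
  finally show ?case by (simp add: add.commute)
qed

text \<open>For \<open>h\<close> outside the centralizer, \<open>k h\<close> is invertible modulo
  the prime \<open>p\<close>, so every \<open>g\<close> is a power of \<open>h\<close> times an
  element centralizing \<open>x\<close>. The element \<open>g\<^sub>0\<close> makes the centralizer
  proper.\<close>

lemma maximal_centralizer:
  assumes "g\<^sub>0 \<in> carrier G" "g\<^sub>0 \<notin> centralizer G x"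
  shows "maximal_subgroup (centralizer G x) G"
proof -
  have "H = carrier G" if H: "subgroup H G" "centralizer G x \<subseteq> H" "H \<noteq> centralizer G x" for H
  proof
    show "H \<subseteq> carrier G"
      using H(1) by (rule subgroup.subset)
    show "carrier G \<subseteq> H"
    proof
      fix g assume g: "g \<in> carrier G"
      obtain h where h: "h \<in> H" "h \<notin> centralizer G x"
        using H by blast
      then have hG: "h \<in> carrier G"
        using \<open>H \<subseteq> carrier G\<close> by blast
      then have "coprime (k h) p"
        using h(2) prime_p prime_imp_coprime [of p "k h"]
        by (simp add: centralizer_iff cong_0_iff coprime_commute)
      then obtain i where i: "[k h * i = 1] (mod p)"
        using cong_solve_coprime_nat [of "k h" p] by auto
      \<comment> \<open>As \<open>i\<close> inverts \<open>k h\<close>, this exponent makes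
        \<open>k y\<close> congruent to \<open>k g\<close>, so the quotient \<open>m\<close> below
        centralizes \<open>x\<close>.\<close>
      define y where "y = h [^] (i * k g)"
      have y: "y \<in> H" "y \<in> carrier G"
        using H(1) h(1) hG unfolding y_def
        by (auto intro: subgroup_nat_pow_closed)
      have "[k y = (k h * i) * k g] (mod p)"
        using k_pow [OF hG, of "i * k g"] by (simp add: y_def mult_ac)
      also have "[(k h * i) * k g = 1 * k g] (mod p)"
        using i by (rule cong_mult) simp
      finally have ky: "[k y = k g] (mod p)"
        by simp
      define m where "m = inv y \<otimes> g"
      have m: "m \<in> carrier G" "y \<otimes> m = g"
        using y g by (auto simp: m_def m_assoc [symmetric])
      have "[k y + k m = k y + 0] (mod p)"
        using k_mult [OF y(2) m(1)] ky m(2) by (metis add.right_neutral cong_sym cong_trans)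
      then have "m \<in> centralizer G x"
        using m(1) by (simp add: centralizer_iff cong_add_lcancel_0_nat)
      then show "g \<in> H"
        using H y(1) m(2) by (metis subgroup.m_closed subsetD)
    qed
  qed
  then show ?thesis
    using assms subgroup_centralizer unfolding maximal_subgroup_def by auto
qed

section \<open>The twisting factors\<close>

lemma x_pow_commute:
  assumes g: "g \<in> carrier G"
  shows "x [^] (i::nat) \<otimes> g = c [^] (i * k g) \<otimes> (g \<otimes> x [^] i)"
proof (induction i)
  case 0
  show ?case using g by simp
next
  case (Suc i)
  have "x [^] Suc i \<otimes> g = x [^] i \<otimes> c [^] k g \<otimes> g \<otimes> x"
    using g by (simp add: k m_assoc)
  also have "\<dots> = c [^] k g \<otimes> (x [^] i \<otimes> g) \<otimes> x"
    using g by (simp add: m_assoc c_pow_commute [of "x [^] i", symmetric])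
  also have "\<dots> = c [^] k g \<otimes> c [^] (i * k g) \<otimes> (g \<otimes> x [^] i \<otimes> x)"
    using g by (simp add: Suc.IH m_assoc)
  finally show ?case
    using g by (simp add: nat_pow_mult m_assoc)
qed

text \<open>The central factor compensates for \<open>x\<close> not commuting with \<open>g\<close>; its exponent is
  \<open>k(g)\<^sup>2 / 2\<close> modulo \<open>p\<close>, which is where \<open>p\<close> odd is needed.\<close>

definition twist :: "nat \<Rightarrow> 'a"
  where "twist i = x [^] i \<otimes> c [^] (Suc p div 2 * i\<^sup>2)"

text \<open>Up to a central factor, \<open>g\<close> goes to \<open>g\<close> times the power of
  \<open>x\<close> with exponent \<open>k g\<close>. The restriction to the carrier provides the
  extensionality required in \<open>auto G\<close>.\<close>

definition twist_auto :: "'a \<Rightarrow> 'a"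
  where "twist_auto = (\<lambda>g \<in> carrier G. g \<otimes> twist (k g))"

lemma twist_closed [simp]: "twist i \<in> carrier G"
  by (simp add: twist_def)

text \<open>The p-th powers of \<open>x\<close> and \<open>c\<close> are trivial, so exponents count
  only modulo \<open>p\<close>. Thus \<open>twist (k g)\<close> does not depend on the
  representative \<open>k g\<close>.\<close>

lemma twist_cong: "[i = j] (mod p) \<Longrightarrow> twist i = twist j"
  unfolding twist_def
  by (intro arg_cong2 [where f = "(\<otimes>)"] pow_cong cong_mult cong_pow)
    (simp_all add: x_pow_p c_pow_p)

lemma twist_0: "twist 0 = \<one>"
  by (simp add: twist_def)

lemma twist_in_centralizer: "twist i \<in> centralizer G x"
proof -
  have "c [^] (j::nat) \<in> centralizer G x" for j
    using c_pow_commute [of x j] by (simp add: centralizer_def)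
  moreover have "x [^] (j::nat) \<in> centralizer G x" for j
    using nat_pow_comm [of x j 1] by (simp add: centralizer_def)
  ultimately show ?thesis
    using subgroup_centralizer [OF x_closed] by (simp add: twist_def subgroup.m_closed)
qed

lemma twist_pow_p: "twist i [^] p = \<one>"
proof -
  have pow: "(a [^] j) [^] p = \<one>" if "a \<in> carrier G" "a [^] p = \<one>" for a and j :: nat
    using that by (metis mult.commute nat_pow_one nat_pow_pow)
  let ?d = "c [^] (Suc p div 2 * i\<^sup>2)"
  have "twist i [^] p = (x [^] i) [^] p \<otimes> ?d [^] p"
    unfolding twist_def by (rule pow_mult_distrib) (simp_all only: c_pow_commute nat_pow_closed x_closed c_closed)
  then show ?thesis
    by (simp only: pow [OF x_closed x_pow_p] pow [OF c_closed c_pow_p] l_one one_closed)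
qed

text \<open>The quadratic exponent of \<open>twist\<close> is chosen for this identity: with
  \<open>e\<close> one half modulo \<open>p\<close>, passing from \<open>i\<close>, \<open>j\<close>
  to \<open>i + j\<close> adds \<open>2 * e * i * j\<close>, which is congruent to
  \<open>i * j\<close>.\<close>

lemma twist_add: "c [^] (i * j) \<otimes> (twist i \<otimes> twist j) = twist (i + j)"
proof -
  \<comment> \<open>For odd \<open>p\<close> the division is exact, so \<open>e\<close> represents
    1/2 modulo \<open>p\<close>.\<close>
  define e where "e = Suc p div 2"
  have e: "2 * e = Suc p"
    using odd_p by (simp add: e_def)
  have "twist i \<otimes> twist j = x [^] i \<otimes> (c [^] (e * i\<^sup>2) \<otimes> x [^] j) \<otimes> c [^] (e * j\<^sup>2)"
    by (simp add: twist_def e_def m_assoc)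
  also have "c [^] (e * i\<^sup>2) \<otimes> x [^] j = x [^] j \<otimes> c [^] (e * i\<^sup>2)"
    by (simp add: c_pow_commute)
  also have "x [^] i \<otimes> (x [^] j \<otimes> c [^] (e * i\<^sup>2)) \<otimes> c [^] (e * j\<^sup>2)
      = x [^] (i + j) \<otimes> c [^] (e * i\<^sup>2 + e * j\<^sup>2)"
    by (simp add: m_assoc flip: nat_pow_mult)
  finally have "c [^] (i * j) \<otimes> (twist i \<otimes> twist j)
      = x [^] (i + j) \<otimes> c [^] (e * i\<^sup>2 + e * j\<^sup>2) \<otimes> c [^] (i * j)"
    by (simp add: c_pow_commute)
  also have "\<dots> = x [^] (i + j) \<otimes> c [^] (e * i\<^sup>2 + e * j\<^sup>2 + i * j)"
    by (simp add: m_assoc nat_pow_mult)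
  also have "c [^] (e * i\<^sup>2 + e * j\<^sup>2 + i * j) = c [^] (e * (i + j)\<^sup>2)"
  proof -
    have "e * (i + j)\<^sup>2 = e * i\<^sup>2 + e * j\<^sup>2 + (2 * e) * (i * j)"
      by (simp add: power2_eq_square algebra_simps)
    then have "e * (i + j)\<^sup>2 = e * i\<^sup>2 + e * j\<^sup>2 + i * j + p * (i * j)"
      by (simp add: e)
    then show ?thesis
      by (simp add: c_pow_eq_iff cong_def)
  qed
  finally show ?thesis
    by (simp add: twist_def e_def)
qed

lemma twist_commute:
  assumes h: "h \<in> carrier G"
  shows "twist i \<otimes> h = c [^] (i * k h) \<otimes> (h \<otimes> twist i)"
proof -
  let ?d = "c [^] (Suc p div 2 * i\<^sup>2)"
  have "twist i \<otimes> h = (x [^] i \<otimes> h) \<otimes> ?d"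
    using h by (simp add: twist_def m_assoc c_pow_commute)
  also have "\<dots> = c [^] (i * k h) \<otimes> (h \<otimes> twist i)"
    using h by (simp add: x_pow_commute twist_def m_assoc)
  finally show ?thesis .
qed

section \<open>The automorphism and its order\<close>

text \<open>Moving \<open>twist (k g)\<close> past \<open>h\<close> costs the central factor
  \<open>c [^] (k g * k h)\<close>, which \<open>twist_add\<close> absorbs when the two twists are
  merged.\<close>

lemma twist_auto_hom: "twist_auto \<in> hom G G"
proof (rule homI)
  fix g h assume g: "g \<in> carrier G" and h: "h \<in> carrier G"
  have "twist_auto g \<otimes> twist_auto h = g \<otimes> (twist (k g) \<otimes> h) \<otimes> twist (k h)"
    using g h by (simp add: twist_auto_def m_assoc)
  also have "\<dots> = (g \<otimes> c [^] (k g * k h)) \<otimes> h \<otimes> twist (k g) \<otimes> twist (k h)"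
    using g h by (simp add: twist_commute [OF h] m_assoc)
  also have "\<dots> = g \<otimes> (h \<otimes> c [^] (k g * k h)) \<otimes> twist (k g) \<otimes> twist (k h)"
    using g by (simp only: m_assoc c_pow_commute [OF h] nat_pow_closed c_closed h)
  also have "\<dots> = g \<otimes> h \<otimes> (c [^] (k g * k h) \<otimes> (twist (k g) \<otimes> twist (k h)))"
    using g h by (simp add: m_assoc)
  also have "\<dots> = g \<otimes> h \<otimes> twist (k g + k h)"
    by (simp only: twist_add)
  also have "twist (k g + k h) = twist (k (g \<otimes> h))"
    using g h by (simp add: twist_cong k_mult cong_sym)
  finally show "twist_auto (g \<otimes> h) = twist_auto g \<otimes> twist_auto h"
    using g h by (simp add: twist_auto_def)
qed (simp add: twist_auto_def)

lemma twist_auto_fixes: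
  assumes "g \<in> centralizer G x"
  shows "twist_auto g = g"
proof -
  have g: "g \<in> carrier G"
    using assms by (simp add: centralizer_def)
  then have "twist (k g) = twist 0"
    using assms by (simp add: twist_cong centralizer_iff)
  then show ?thesis
    using g by (simp add: twist_auto_def twist_0)
qed

text \<open>Twists centralize \<open>x\<close> and are therefore fixed by \<open>twist_auto\<close>,
  so each application contributes the same factor \<open>twist (k g)\<close>.\<close>

lemma twist_auto_funpow:
  assumes g: "g \<in> carrier G"
  shows "(twist_auto ^^ i) g = g \<otimes> twist (k g) [^] i"
proof (induction i)
  case 0
  show ?case using g by simp
next
  case (Suc i)
  let ?t = "twist (k g) [^] i"
  have "?t \<in> centralizer G x"
    using twist_in_centralizer subgroup_centralizer [OF x_closed]
    by (auto intro: subgroup_nat_pow_closed)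
  then have "twist_auto ?t = ?t"
    by (rule twist_auto_fixes)
  moreover have "twist_auto (g \<otimes> ?t) = twist_auto g \<otimes> twist_auto ?t"
    using twist_auto_hom g by (simp add: hom_mult)
  ultimately have "twist_auto (g \<otimes> ?t) = g \<otimes> twist (k g) \<otimes> ?t"
    using g by (simp add: twist_auto_def)
  then show ?case
    using g Suc.IH nat_pow_Suc2 [of "twist (k g)" i] by (simp add: m_assoc)
qed

text \<open>The p-th iterate is the identity on the carrier because twists have trivial p-th power;
  hence the iterate of index \<open>p - 1\<close> is the inverse map.\<close>

lemma twist_auto_in_auto: "twist_auto \<in> auto G"
proof -
  have closed: "(twist_auto ^^ i) g \<in> carrier G" if "g \<in> carrier G" for g i
    using that by (simp add: twist_auto_funpow)
  have id: "(twist_auto ^^ p) g = g" if "g \<in> carrier G" for g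
    using that by (simp add: twist_auto_funpow twist_pow_p)
  have p: "p = Suc (p - 1)"
    using prime_p prime_gt_0_nat by simp
  have "bij_betw twist_auto (carrier G) (carrier G)"
  proof (rule bij_betw_byWitness [where f' = "twist_auto ^^ (p - 1)"])
    show "\<forall>g\<in>carrier G. (twist_auto ^^ (p - 1)) (twist_auto g) = g"
      using id p by (metis comp_apply funpow_Suc_right)
    show "\<forall>g\<in>carrier G. twist_auto ((twist_auto ^^ (p - 1)) g) = g"
      using id p by (metis comp_apply funpow.simps(2))
  qed (use closed [of _ 1] closed in auto)
  then show ?thesis
    using twist_auto_hom by (simp add: auto_def Bij_def twist_auto_def)
qed

text \<open>Multiplication in \<open>AutoGroup G\<close> is composition restricted to the carrier.
  The restriction on the right matters already at \<open>i = 0\<close>, where the iterate is the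
  unrestricted identity.\<close>

lemma twist_auto_pow:
  "twist_auto [^]\<^bsub>AutoGroup G\<^esub> (i::nat) = (\<lambda>g \<in> carrier G. (twist_auto ^^ i) g)"
proof (induction i)
  case 0
  show ?case
    by (simp add: AutoGroup_def BijGroup_def nat_pow_def)
next
  case (Suc i)
  interpret A: group "AutoGroup G" by (rule AutoGroup)
  have t: "twist_auto \<in> carrier (AutoGroup G)"
    using twist_auto_in_auto by (simp add: AutoGroup_def)
  have Bij: "f \<in> Bij (carrier G)" if "f \<in> carrier (AutoGroup G)" for f
    using that by (simp add: AutoGroup_def auto_def)
  have "twist_auto [^]\<^bsub>AutoGroup G\<^esub> Suc i
      = compose (carrier G) (twist_auto [^]\<^bsub>AutoGroup G\<^esub> i) twist_auto"
    using Bij [OF t] Bij [OF A.nat_pow_closed [OF t, of i]]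
    by (simp add: AutoGroup_def BijGroup_def)
  then show ?case
    unfolding Suc.IH using hom_in_carrier [OF twist_auto_hom]
    by (auto simp: compose_def funpow_swap1 fun_eq_iff)
qed

lemma ord_twist_auto:
  assumes "twist_auto \<noteq> (\<lambda>g \<in> carrier G. g)"
  shows "group.ord (AutoGroup G) twist_auto = p"
proof -
  interpret A: group "AutoGroup G" by (rule AutoGroup)
  have t: "twist_auto \<in> carrier (AutoGroup G)"
    using twist_auto_in_auto by (simp add: AutoGroup_def)
  have one: "\<one>\<^bsub>AutoGroup G\<^esub> = (\<lambda>g \<in> carrier G. g)"
    by (simp add: AutoGroup_def BijGroup_def)
  have "twist_auto [^]\<^bsub>AutoGroup G\<^esub> p = \<one>\<^bsub>AutoGroup G\<^esub>"
    unfolding twist_auto_pow one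
    by (rule restrict_ext) (simp add: twist_auto_funpow twist_pow_p)
  then have "A.ord twist_auto dvd p"
    using t by (simp add: A.pow_eq_id)
  moreover have "A.ord twist_auto \<noteq> 1"
    using assms A.ord_eq_1 [OF t] one by simp
  ultimately show ?thesis
    using prime_p prime_nat_iff by blast
qed

section \<open>Non-innerness\<close>

text \<open>A conjugating \<open>h\<close> commutes with the whole centralizer of \<open>x\<close>,
  which contains \<open>x\<close>, so \<open>h\<close> lies in the center of that centralizer.
  Premise \<open>Z\<close> then makes the commutator of \<open>h\<close> and \<open>g\<close>
  central, and this commutator is a conjugate of \<open>twist 1\<close>.\<close>

lemma twist_auto_not_inner:
  assumes x: "x \<notin> center G" and g: "g \<in> carrier G" "[k g = 1] (mod p)"
    and Z: "\<And>h u. \<lbrakk>h \<in> center (G\<lparr>carrier := centralizer G x\<rparr>); u \<in> carrier G\<rbrakk>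
      \<Longrightarrow> h \<otimes> u \<otimes> inv h \<otimes> inv u \<in> center G"
  shows "twist_auto \<notin> inner_auto G"
proof
  assume "twist_auto \<in> inner_auto G"
  then obtain h where h: "h \<in> carrier G"
    and conj: "\<And>u. u \<in> carrier G \<Longrightarrow> twist_auto u = h \<otimes> u \<otimes> inv h"
    unfolding inner_auto_def by auto
  have comm: "h \<otimes> u = u \<otimes> h" if u: "u \<in> centralizer G x" for u
  proof -
    have uG: "u \<in> carrier G"
      using u by (simp add: centralizer_def)
    then have "h \<otimes> u \<otimes> inv h = u"
      using conj [OF uG] twist_auto_fixes [OF u] by simp
    then show ?thesis
      using h uG by (metis inv_solve_right' m_closed)
  qed
  have "x \<in> centralizer G x"
    by (simp add: centralizer_def)
  then have "h \<in> centralizer G x"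
    using h comm by (simp add: centralizer_def)
  then have "h \<in> center (G\<lparr>carrier := centralizer G x\<rparr>)"
    using comm by (simp add: center_def)
  then have "h \<otimes> g \<otimes> inv h \<otimes> inv g \<in> center G"
    using Z g by blast
  moreover have "h \<otimes> g \<otimes> inv h = g \<otimes> twist 1"
    using conj [OF g(1)] g(1) twist_cong [OF g(2)] by (simp add: twist_auto_def)
  ultimately have z: "g \<otimes> twist 1 \<otimes> inv g \<in> center G" (is "?z \<in> _")
    by simp
  \<comment> \<open>A central conjugate equals the element it is conjugate to: cancelling
    \<open>g\<close> identifies \<open>?z\<close> with \<open>twist 1\<close>.\<close>
  have "g \<otimes> twist 1 = g \<otimes> ?z"
    using g z center_commute [OF z g(1)] by (simp add: m_assoc)
  then have "twist 1 \<in> center G"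
    using g z center_closed [OF z] by simp
  moreover have "x = twist 1 \<otimes> inv (c [^] (Suc p div 2))"
    by (simp add: twist_def m_assoc)
  ultimately have "x \<in> center G"
    using c_pow_center subgroup_center by (metis subgroup.m_closed subgroup.m_inv_closed)
  with x show False ..
qed

end

section \<open>The non-inner automorphism\<close>

text \<open>By Lagrange the order of \<open>c\<close> divides \<open>p\<close> and is not one, so
  the powers of \<open>c\<close> already exhaust \<open>H\<close>. Natural exponents suffice since
  this order is nonzero.\<close>

lemma (in group) powers_of_prime_order_subgroup:
  assumes H: "subgroup H G" "card H = p" and p: "Factorial_Ring.prime p"
    and c: "c \<in> H" "c \<noteq> \<one>"
  shows "ord c = p" and "\<And>d. d \<in> H \<Longrightarrow> \<exists>i::nat. d = c [^] i"
proof -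
  have cG: "c \<in> carrier G"
    using H(1) c(1) by (rule subgroup.mem_carrier)
  interpret H: group "G\<lparr>carrier := H\<rparr>"
    using H(1) by (rule subgroup_imp_group)
  have fin: "finite H"
    using H(2) p by (metis card.infinite not_prime_0)
  have pow: "c [^]\<^bsub>G\<lparr>carrier := H\<rparr>\<^esub> (i::nat) = c [^] i" for i
    by (simp flip: nat_pow_consistent)
  have "c [^] p = \<one>"
    using H.pow_order_eq_1 [of c] c(1) H(2) by (simp add: order_def pow)
  then have "ord c dvd p"
    using cG by (simp add: pow_eq_id)
  moreover have "ord c \<noteq> 1"
    using c(2) ord_eq_1 [OF cG] by blast
  ultimately show ord: "ord c = p"
    using p prime_nat_iff by blast
  have sub: "generate G {c} \<subseteq> H"
    using H(1) c(1) by (simp add: generate_subgroup_incl)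
  have "card (generate G {c}) = p"
    using generate_pow_card [OF cG] ord by simp
  with sub fin have eq: "generate G {c} = H"
    using H(2) by (simp add: card_subset_eq)
  show "\<exists>i::nat. d = c [^] i" if "d \<in> H" for d
  proof -
    have "generate G {c} = {c [^] i | i. i \<in> (UNIV :: nat set)}"
      using generate_pow_nat [OF cG] ord p by (metis not_prime_0)
    then show ?thesis
      using that eq by auto
  qed
qed

text \<open>In a finite group the order is an admissible exponent, so the \<open>LEAST\<close> in
  \<open>group_exponent\<close> is attained.\<close>

lemma (in group) pow_group_exponent:
  assumes "finite (carrier G)" "a \<in> carrier G"
  shows "a [^] group_exponent G = \<one>"
proof -
  have "order G > 0 \<and> (\<forall>a \<in> carrier G. a [^] order G = \<one>)"
    using assms(1) by (simp add: order_gt_0_iff_finite pow_order_eq_1)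
  then have "group_exponent G > 0 \<and> (\<forall>a \<in> carrier G. a [^] group_exponent G = \<one>)"
    unfolding group_exponent_def by (rule LeastI)
  then show ?thesis
    using assms(2) by blast
qed

theorem corollary2p2:
  fixes G :: "('a, 'b) monoid_scheme" and p n :: nat
  assumes "Factorial_Ring.prime p" and "p > 2"
    and "finite_p_group p G"
    and "n \<ge> 4" and "has_nilpotency_class G n"
    and "card (center G) = p"
    and "group_exponent (G\<lparr>carrier := lower_central G (n - 1)\<rparr>) = p"
    and "\<forall>x \<in> lower_central G (n - 1) - center G.
           center (G\<lparr>carrier := centralizer G x\<rparr>) \<subseteq> lower_central G (n - 1)"
  shows "\<exists>\<alpha> \<in> auto G.
           \<alpha> \<notin> inner_auto G \<and>
           group.ord (AutoGroup G) \<alpha> = p \<and>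
           (\<forall>u \<in> frattini G. \<alpha> u = u)"
proof -
  interpret group G
    using assms(3) by (simp add: finite_p_group_def)
  have fin: "finite (carrier G)"
    using assms(3) by (simp add: finite_p_group_def)
  let ?L = "lower_central G (n - 1)"
  \<comment> \<open>This form of \<open>n\<close> exposes the recursive equation of
    \<open>lower_central\<close> at the indices \<open>n\<close> and \<open>n + 1\<close>.\<close>
  obtain m where m: "n = Suc (Suc m)"
    using \<open>n \<ge> 4\<close> by (metis add_2_eq_Suc le_Suc_ex numeral_Bit0 add.assoc)
  have L_sub: "?L \<subseteq> carrier G"
    by (rule lower_central_subset)
  have \<gamma>\<^sub>n: "lower_central G n = commutator_subgroup G ?L (carrier G)"
    by (simp add: m)
  \<comment> \<open>The commutator lies in \<open>lower_central G n\<close>, and the next term of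
    the series is trivial, so it commutes with everything.\<close>
  have comm_L: "h \<otimes>\<^bsub>G\<^esub> u \<otimes>\<^bsub>G\<^esub> inv\<^bsub>G\<^esub> h \<otimes>\<^bsub>G\<^esub> inv\<^bsub>G\<^esub> u \<in> center G"
    if h: "h \<in> ?L" and u: "u \<in> carrier G" for h u
  proof -
    let ?z = "h \<otimes>\<^bsub>G\<^esub> u \<otimes>\<^bsub>G\<^esub> inv\<^bsub>G\<^esub> h \<otimes>\<^bsub>G\<^esub> inv\<^bsub>G\<^esub> u"
    have z: "?z \<in> lower_central G n"
      unfolding \<gamma>\<^sub>n using h u by (rule commutator_in_commutator_subgroup)
    have zG: "?z \<in> carrier G"
      using z lower_central_subset by blast
    have "?z \<otimes>\<^bsub>G\<^esub> v = v \<otimes>\<^bsub>G\<^esub> ?z" if v: "v \<in> carrier G" for v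
    proof (rule commute_if_commutator_one [OF zG v])
      have "commutator_subgroup G (lower_central G n) (carrier G) = {\<one>\<^bsub>G\<^esub>}"
        using assms(5) by (simp add: has_nilpotency_class_def m)
      then show "?z \<otimes>\<^bsub>G\<^esub> v \<otimes>\<^bsub>G\<^esub> inv\<^bsub>G\<^esub> ?z \<otimes>\<^bsub>G\<^esub> inv\<^bsub>G\<^esub> v = \<one>\<^bsub>G\<^esub>"
        using commutator_in_commutator_subgroup [OF z v] by blast
    qed
    with zG show ?thesis
      by (rule centerI)
  qed
  obtain x g where x: "x \<in> ?L" and g: "g \<in> carrier G" and xg: "x \<otimes>\<^bsub>G\<^esub> g \<noteq> g \<otimes>\<^bsub>G\<^esub> x"
    using assms(5) commutator_subgroup_trivial [OF L_sub, of "carrier G"] \<gamma>\<^sub>n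
    by (auto simp: has_nilpotency_class_def m)
  have xG: "x \<in> carrier G"
    using x L_sub by blast
  have x_notin: "x \<notin> center G"
    using xg g by (auto simp: center_def)
  \<comment> \<open>Any nontrivial central element generates the center of order \<open>p\<close>;
    taking the commutator of \<open>x\<close> and \<open>g\<close> itself gives \<open>k g\<close>
    the value 1 modulo \<open>p\<close>.\<close>
  define c where "c = x \<otimes>\<^bsub>G\<^esub> g \<otimes>\<^bsub>G\<^esub> inv\<^bsub>G\<^esub> x \<otimes>\<^bsub>G\<^esub> inv\<^bsub>G\<^esub> g"
  have c: "c \<in> center G" "c \<noteq> \<one>\<^bsub>G\<^esub>"
    using comm_L [OF x g] commute_if_commutator_one [OF xG g] xg by (auto simp: c_def)
  note c_powers = powers_of_prime_order_subgroup [OF subgroup_center assms(6,1) c]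
  \<comment> \<open>For \<open>u\<close> in the carrier a suitable exponent exists, since the
    commutator is central and hence a power of \<open>c\<close>.\<close>
  define k where "k u = (SOME i. x \<otimes>\<^bsub>G\<^esub> u \<otimes>\<^bsub>G\<^esub> inv\<^bsub>G\<^esub> x \<otimes>\<^bsub>G\<^esub> inv\<^bsub>G\<^esub> u = c [^]\<^bsub>G\<^esub> (i::nat))" for u
  have xp: "x [^]\<^bsub>G\<^esub> p = \<one>\<^bsub>G\<^esub>"
  proof -
    interpret L: group "G\<lparr>carrier := ?L\<rparr>"
      by (rule subgroup_imp_group [OF subgroup_lower_central])
    have "x [^]\<^bsub>G\<lparr>carrier := ?L\<rparr>\<^esub> p = \<one>\<^bsub>G\<^esub>"
      using L.pow_group_exponent [of x] x fin L_sub assms(7) by (simp add: finite_subset)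
    then show ?thesis
      by (simp flip: nat_pow_consistent)
  qed
  interpret prime_commutator G p x c k
  proof
    show "Factorial_Ring.prime p" "x \<in> carrier G" "x [^]\<^bsub>G\<^esub> p = \<one>\<^bsub>G\<^esub>" "c \<in> center G" "ord c = p"
      using assms(1) xG xp c(1) c_powers(1) by auto
    show "odd p"
      using assms(1,2) by (rule prime_odd_nat)
    show "x \<otimes>\<^bsub>G\<^esub> u = c [^]\<^bsub>G\<^esub> k u \<otimes>\<^bsub>G\<^esub> (u \<otimes>\<^bsub>G\<^esub> x)" if u: "u \<in> carrier G" for u
      using commutator_mult [OF xG u] someI_ex [OF c_powers(2) [OF comm_L [OF x u]]] by (simp add: k_def)
  qed
  have kg: "[k g = 1] (mod p)"
    using commutator_mult [OF xG g] g by (simp add: k_cong_iff flip: c_def)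
  have g_notin: "g \<notin> centralizer G x"
    using xg by (simp add: centralizer_def)
  have not_inner: "twist_auto \<notin> inner_auto G"
    using x_notin g kg
  proof (rule twist_auto_not_inner)
    \<comment> \<open>The hypothesis on the center of the centralizer places \<open>h\<close> in
      \<open>?L\<close>, where \<open>comm_L\<close> applies.\<close>
    fix h u assume "h \<in> center (G\<lparr>carrier := centralizer G x\<rparr>)" "u \<in> carrier G"
    then show "h \<otimes>\<^bsub>G\<^esub> u \<otimes>\<^bsub>G\<^esub> inv\<^bsub>G\<^esub> h \<otimes>\<^bsub>G\<^esub> inv\<^bsub>G\<^esub> u \<in> center G"
      using assms(8) x x_notin comm_L by blast
  qed
  \<comment> \<open>The identity is inner, so the non-inner \<open>twist_auto\<close> differs from
    it, as \<open>ord_twist_auto\<close> requires.\<close>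
  have "(\<lambda>u \<in> carrier G. u) \<in> inner_auto G"
    unfolding inner_auto_def by (rule image_eqI [where x = "\<one>\<^bsub>G\<^esub>"]) (auto intro: restrict_ext)
  then have "group.ord (AutoGroup G) twist_auto = p"
    using not_inner by (metis ord_twist_auto)
  \<comment> \<open>The centralizer of \<open>x\<close> is a maximal subgroup, so it contains
    \<open>frattini G\<close>.\<close>
  moreover have "twist_auto u = u" if "u \<in> frattini G" for u
    using that maximal_centralizer [OF g g_notin] by (auto simp: frattini_def intro: twist_auto_fixes)
  ultimately show ?thesis
    using twist_auto_in_auto not_inner by blast
qed

end
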